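(* Consider a canonical-link generalized linear model with cumulant $F(\theta)=\sum_{i=1}^n b(\theta_i)$, design matrix $X$, model manifold $\mathcal E_X=\{X\beta:\beta\in\mathbb R^p\}=\operatorname{col}(X)$ in the natural coordinate, and response $y$ with saturated natural parameter $\theta_y$, defined by $\nabla F(\theta_y)=y$. Then, up to an additive constant independent of $\theta$, the negative log-likelihood is the Bregman divergence to the saturated natural parameter: $$D_F(\theta\,\|\,\theta_y)=-\ell(\theta)+\mathrm{const},\qquad \ell(\theta)=\langle y,\theta\rangle-F(\theta)+\mathrm{const}.$$ Hence maximizing the likelihood is equivalent to $$\hat\theta=X\hat\beta=\arg\min_{\theta\in\mathcal E_X}D_F(\theta\,\|\,\theta_y).$$ Provided the finite maximum-likelihood estimate $\hat\theta=X\hat\beta$ exists, with $\hat\mu=\nabla F(X\hat\beta)$: (i) the score equation $X^\top(y-\hat\mu)=0$ holds; (ii) for every $\theta\in\mathcal E_X$, $$D_F(\theta\,\|\,\theta_y)=D_F(\theta\,\|\,\hat\theta)+D_F(\hat\theta\,\|\,\theta_y);$$ (iii) correspondingly, in the mean coordinate, with $\mu=\nabla F(\theta)$, $$D_G(y\,\|\,\mu)=D_G(y\,\|\,\hat\mu)+D_G(\hat\mu\,\|\,\mu).$$ Thus the same fit is, in the natural coordinate, the projection $\min_{\theta\in\mathcal E_X}D_F(\theta\|\theta_y)$ (an e-projection relative to the $F$-geometry: the first argument varies) and, in the mean coordinate, the dual m-projection $\min_{\mu\in\nabla F(\mathcal E_X)}D_G(y\|\mu)$ (the second argument varies). The model deviance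 is $D_G(y\|\hat\mu)$, up to the conventional factor of two.
   Context: Each response $y_i$, $i=1,\dots,n$, follows a regular exponential-family law with cumulant (log-partition) function $b$; the dispersion parameter is set to one. $\theta=(\theta_1,\dots,\theta_n)$ is the natural parameter, $F(\theta)=\sum_i b(\theta_i)$, the mean is $\mu=\nabla F(\theta)$, and $G=F^*$ is the convex (Legendre) conjugate of $F$, the mean-domain generator, with $\nabla G=(\nabla F)^{-1}$. For $H\in\{F,G\}$, $D_H(u\|v)=H(u)-H(v)-\langle\nabla H(v),u-v\rangle$, and $D_F(u\|v)=D_G(\nabla F(v)\|\nabla F(u))$. $X$ is the $n\times p$ design matrix and $\beta\in\mathbb R^p$ the regression coefficient. A GLM ties the mean to the linear predictor by $g_{\mathrm{link}}(\mu)=X\beta$; the canonical link is $g_{\mathrm{link}}=\nabla G=(\nabla F)^{-1}$, so that $\theta=X\beta$. Boundary convention: the saturated natural parameter can be infinite (e.g. $\theta_{y_i}=\pm\infty$ for Bernoulli responses $y_i\in\{0,1\}$, or $\theta_{y_i}=-\infty$ for Poisson responses $y_i=0$); then $\nabla F(\theta_y)=y$ and $F(\theta_y)$ are read in the extended closure sense and the deviance is defined by the corresponding limiting values. Existence of a finite $\hat\theta=X\hat\beta$ is not automatic (it can fail e.g. under complete or quasi-complete separation in logistic regression).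
   Formalization: Responses lie where the density's carrier is positive; if some coordinate of the saturated parameter is infinite, G(y) is assumed finite. Otherwise (e.g. exponential responses with y_i=0) D_F(·‖θ_y) is identically infinite and cannot equal −ℓ plus a constant. *)

theory Defs
  imports "HOL-Analysis.Analysis"
begin

section \<open>Regular one-parameter exponential families\<close>

text \<open>A family is given by a dominating measure \<open>M\<close> on the reals and a carrier function \<open>h\<close>;
  the law with natural parameter \<open>\<theta>\<close> has density \<open>h x * exp (\<theta> * x - b \<theta>)\<close> with respect to \<open>M\<close>.\<close>

definition natural_space :: "real measure \<Rightarrow> (real \<Rightarrow> real) \<Rightarrow> real set" where
  "natural_space M h = {\<theta>. integrable M (\<lambda>x. h x * exp (\<theta> * x))}"

text \<open>The cumulant function \<open>b\<close>, with the usual value \<open>\<infinity>\<close> outside the natural parameter space.\<close>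

definition cumulant :: "real measure \<Rightarrow> (real \<Rightarrow> real) \<Rightarrow> real \<Rightarrow> ereal" where
  "cumulant M h \<theta> =
     (if \<theta> \<in> natural_space M h then ereal (ln (LINT x|M. h x * exp (\<theta> * x))) else \<infinity>)"

text \<open>Regular means full with open natural parameter space, and minimal; for a scalar statistic,
  minimality says that the laws are not concentrated at a single point. The last clause also
  excludes the case in which \<open>h\<close> vanishes almost everywhere.\<close>

definition regular_expfam :: "real measure \<Rightarrow> (real \<Rightarrow> real) \<Rightarrow> bool" where
  "regular_expfam M h \<longleftrightarrow>
     sets M = sets borel \<and> h \<in> borel_measurable borel \<and> (\<forall>x. 0 \<le> h x) \<and>
     natural_space M h \<noteq> {} \<and> open (natural_space M h) \<and>
     \<not> (\<exists>c. AE x in M. 0 < h x \<longrightarrow> x = c)"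

definition expfam_density :: "real measure \<Rightarrow> (real \<Rightarrow> real) \<Rightarrow> real \<Rightarrow> real \<Rightarrow> real" where
  "expfam_density M h \<theta> x = h x * exp (\<theta> * x - real_of_ereal (cumulant M h \<theta>))"

section \<open>Generators, conjugates and Bregman divergences\<close>

text \<open>Generators are extended-valued convex functions. The gradient is that of the real part, so it
  is meaningful only at interior points of the effective domain.\<close>

definition gradient :: "('a::real_inner \<Rightarrow> ereal) \<Rightarrow> 'a \<Rightarrow> 'a" where
  "gradient H v = (THE D. GDERIV (\<lambda>u. real_of_ereal (H u)) v :> D)"

definition bregman :: "('a::real_inner \<Rightarrow> ereal) \<Rightarrow> 'a \<Rightarrow> 'a \<Rightarrow> ereal" where
  "bregman H u v = H u - H v - ereal (gradient H v \<bullet> (u - v))"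

definition convex_conjugate :: "('a::real_inner \<Rightarrow> ereal) \<Rightarrow> 'a \<Rightarrow> ereal" where
  "convex_conjugate H u = (SUP \<theta>. ereal (u \<bullet> \<theta>) - H \<theta>)"

section \<open>The model with canonical link\<close>

definition natural_domain :: "real measure \<Rightarrow> (real \<Rightarrow> real) \<Rightarrow> (real ^ 'n) set" where
  "natural_domain M h = {\<theta>. \<forall>i. \<theta> $ i \<in> natural_space M h}"

definition total_cumulant :: "real measure \<Rightarrow> (real \<Rightarrow> real) \<Rightarrow> real ^ 'n \<Rightarrow> ereal" where
  "total_cumulant M h \<theta> = (\<Sum>i\<in>UNIV. cumulant M h (\<theta> $ i))"

definition log_likelihood ::
    "real measure \<Rightarrow> (real \<Rightarrow> real) \<Rightarrow> real ^ 'n \<Rightarrow> real ^ 'n \<Rightarrow> ereal" where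
  "log_likelihood M h y \<theta> =
     (if \<theta> \<in> natural_domain M h
      then ereal (ln (\<Prod>i\<in>UNIV. expfam_density M h (\<theta> $ i) (y $ i))) else - \<infinity>)"

definition model_manifold :: "real ^ 'p ^ 'n \<Rightarrow> (real ^ 'n) set" where
  "model_manifold X = range (\<lambda>\<beta>. X *v \<beta>)"

text \<open>The canonical link makes \<open>X *v \<beta>\<close> the natural parameter. A finite maximum-likelihood estimate
  is required to lie in the natural parameter space, i.e. to have finite log-likelihood.\<close>

definition finite_mle ::
    "real measure \<Rightarrow> (real \<Rightarrow> real) \<Rightarrow> real ^ 'p ^ 'n \<Rightarrow> real ^ 'n \<Rightarrow> real ^ 'p \<Rightarrow> bool" where
  "finite_mle M h X y \<beta> \<longleftrightarrow>
     X *v \<beta> \<in> natural_domain M h \<and>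
     is_arg_max (\<lambda>\<beta>. log_likelihood M h y (X *v \<beta>)) (\<lambda>_. True) \<beta>"

section \<open>Values at possibly infinite natural parameters\<close>

definition embed :: "real ^ 'n \<Rightarrow> ereal ^ 'n" where
  "embed t = (\<chi> i. ereal (t $ i))"

definition toward :: "(real ^ 'n) set \<Rightarrow> ereal ^ 'n \<Rightarrow> (real ^ 'n) filter" where
  "toward S s = inf (filtercomap embed (nhds s)) (principal S)"

text \<open>The value of \<open>f\<close> at \<open>s\<close> is the literal one if \<open>s\<close> is a point of \<open>S\<close>, and otherwise the limit of \<open>f t\<close>
  as \<open>t\<close> tends to \<open>s\<close> within \<open>S\<close>. The filter must be proper, since otherwise every \<open>l\<close> is a limit.\<close>

definition has_extended_value ::
    "(real ^ 'n) set \<Rightarrow> (real ^ 'n \<Rightarrow> 'b::topological_space) \<Rightarrow> ereal ^ 'n \<Rightarrow> 'b \<Rightarrow> bool" where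
  "has_extended_value S f s l \<longleftrightarrow>
     (if s \<in> embed ` S then \<exists>t\<in>S. embed t = s \<and> f t = l
      else toward S s \<noteq> bot \<and> (f \<longlongrightarrow> l) (toward S s))"

definition extended_value ::
    "(real ^ 'n) set \<Rightarrow> (real ^ 'n \<Rightarrow> 'b::topological_space) \<Rightarrow> ereal ^ 'n \<Rightarrow> 'b" where
  "extended_value S f s = (THE l. has_extended_value S f s l)"

definition saturated_parameter ::
    "real measure \<Rightarrow> (real \<Rightarrow> real) \<Rightarrow> real ^ 'n \<Rightarrow> ereal ^ 'n \<Rightarrow> bool" where
  "saturated_parameter M h y s \<longleftrightarrow>
     has_extended_value (natural_domain M h) (gradient (total_cumulant M h)) s y"

definition bregman_to_saturated ::
    "real measure \<Rightarrow> (real \<Rightarrow> real) \<Rightarrow> real ^ 'n \<Rightarrow> ereal ^ 'n \<Rightarrow> ereal" where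
  "bregman_to_saturated M h \<theta> s =
     extended_value (natural_domain M h) (\<lambda>t. bregman (total_cumulant M h) \<theta> t) s"

text \<open>The deviance with the conventional factor two: twice the gap between the saturated
  log-likelihood and the log-likelihood at \<open>\<theta>\<close>.\<close>

definition deviance ::
    "real measure \<Rightarrow> (real \<Rightarrow> real) \<Rightarrow> real ^ 'n \<Rightarrow> ereal ^ 'n \<Rightarrow> real ^ 'n \<Rightarrow> ereal" where
  "deviance M h y s \<theta> =
     2 * (extended_value (natural_domain M h) (log_likelihood M h y) s - log_likelihood M h y \<theta>)"

end

theory Submission
  imports Defs
begin

text \<open>On the natural domain, \<open>F\<close> is a smooth strictly convex function whose gradient is the mean map, and
  off the domain it is infinite. Hence \<open>F\<close> and its conjugate \<open>G\<close> form a Legendre pair, and everything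
  follows from \<open>D\<^sub>F(\<theta> \<parallel> \<theta>\<^sub>y) = F \<theta> + G y - y \<bullet> \<theta>\<close> together with the score equation, which says that \<open>y - \<mu>\<close>
  is orthogonal to the model at the estimate. The delicate point is this formula when \<open>\<theta>\<^sub>y\<close> is not in the
  domain: by steepness some coordinate is then infinite, and the limit exists because
  \<open>(y - \<nabla>F t) \<bullet> (\<theta> - t)\<close> tends to 0 whenever \<open>G y\<close> is finite.\<close>

subsection \<open>Moments of exponential families\<close>

text \<open>The lower bound is \<open>1 + u \<le> exp u\<close>. For the upper one, the same
  inequality at \<open>- u\<close> gives \<open>exp u - 1 \<le> u * exp u\<close>, which reduces the
  remainder to \<open>u * (exp u - 1)\<close>; the sign of \<open>u\<close> decides which of the two
  inequalities bounds this.\<close>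

lemma exp_linear_remainder_le:
  fixes u :: real
  shows "\<bar>exp u - 1 - u\<bar> \<le> u\<^sup>2 * exp \<bar>u\<bar>"
proof -
  have 0: "0 \<le> exp u - 1 - u" using exp_ge_add_one_self[of u] by linarith
  have "exp u * (1 - u) \<le> exp u * exp (- u)"
    using exp_ge_add_one_self[of "- u"] by (intro mult_left_mono) auto
  then have 1: "exp u - 1 \<le> u * exp u" by (simp add: exp_minus algebra_simps)
  then have 2: "exp u - 1 - u \<le> u * (exp u - 1)" by (simp add: algebra_simps)
  have "u * (exp u - 1) \<le> u\<^sup>2 * exp \<bar>u\<bar>"
  proof (cases "0 \<le> u")
    case True
    then show ?thesis using mult_left_mono[OF 1 True] by (simp add: power2_eq_square mult.assoc)
  next
    case False
    have "u * (exp u - 1) \<le> u * u" using False exp_ge_add_one_self[of u]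
      by (intro mult_left_mono_neg) linarith+
    also have "\<dots> \<le> u\<^sup>2 * exp \<bar>u\<bar>"
      using mult_left_mono[of 1 "exp \<bar>u\<bar>" "u\<^sup>2"] by (simp add: power2_eq_square)
    finally show ?thesis .
  qed
  with 0 2 show ?thesis by simp
qed

text \<open>The left side is one of the two summands, depending on the sign of \<open>x\<close>.
  This trades a two-sided exponential weight for two integrands known to be integrable.\<close>

lemma exp_abs_le_sum: "exp (a * x + d * \<bar>x\<bar>) \<le> exp ((a + d) * x) + exp ((a - d) * (x::real))"
  by (cases "0 \<le> x") (auto simp: algebra_simps)

text \<open>Differentiation under the integral with an explicit quadratic remainder. The room around
  \<open>a\<close> in the open set \<open>N\<close> pays for the polynomial factors. The function
  \<open>f\<close> may change sign, so the lemma also applies to \<open>x * h x\<close>, which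
  yields continuity of the mean.\<close>

lemma exp_moment:
  fixes f :: "real \<Rightarrow> real"
  assumes sets: "sets M = sets borel" and f: "f \<in> borel_measurable borel"
    and N: "open N" and int: "\<And>t. t \<in> N \<Longrightarrow> integrable M (\<lambda>x. f x * exp (t * x))"
    and a: "a \<in> N"
  shows integrable_exp_moment: "integrable M (\<lambda>x. x * f x * exp (a * x))" (is ?I)
    and DERIV_exp_moment: "((\<lambda>t. LINT x|M. f x * exp (t * x)) has_real_derivative
           (LINT x|M. x * f x * exp (a * x))) (at a)" (is ?D)
proof -
  have fM [measurable]: "f \<in> borel_measurable M" and idM [measurable]: "(\<lambda>x. x) \<in> borel_measurable M"
    using f sets by (auto simp: measurable_cong_sets[OF sets refl])
  obtain r where r: "0 < r" "cball a r \<subseteq> N"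
    using N a open_contains_cball by blast
  have mem: "a + t \<in> N" if "\<bar>t\<bar> \<le> r" for t
    using r that by (auto simp: subset_iff dist_real_def)
  \<comment> \<open>An integrable envelope for
    \<open>\<bar>f x\<bar> * exp (a * x + r * \<bar>x\<bar>)\<close>; both exponents
    \<open>a + r\<close> and \<open>a - r\<close> lie in \<open>N\<close>.\<close>
  define w where "w x = \<bar>f x\<bar> * (exp ((a + r) * x) + exp ((a - r) * x))" for x
  have iw: "integrable M w"
  proof -
    have "integrable M (\<lambda>x. \<bar>f x * exp ((a + r) * x)\<bar> + \<bar>f x * exp ((a + (- r)) * x)\<bar>)"
      using r by (intro Bochner_Integration.integrable_add integrable_abs int mem) auto
    moreover have "(\<lambda>x. \<bar>f x * exp ((a + r) * x)\<bar> + \<bar>f x * exp ((a + (- r)) * x)\<bar>) = w"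
      by (auto simp: w_def abs_mult algebra_simps)
    ultimately show ?thesis by simp
  qed
  have w0: "0 \<le> w x" for x by (auto simp: w_def)
  have wb: "\<bar>f x\<bar> * exp (a * x + r * \<bar>x\<bar>) \<le> w x" for x
    unfolding w_def by (intro mult_left_mono exp_abs_le_sum) auto
  show I: ?I
  proof (rule Bochner_Integration.integrable_bound)
    show "integrable M (\<lambda>x. w x / r)" using iw by simp
    show "AE x in M. norm (x * f x * exp (a * x)) \<le> norm (w x / r)"
    proof (rule AE_I2)
      fix x
      have "r * \<bar>x\<bar> \<le> exp (r * \<bar>x\<bar>)" using exp_ge_add_one_self[of "r * \<bar>x\<bar>"] by linarith
      then have "(\<bar>f x\<bar> * exp (a * x)) * (r * \<bar>x\<bar>) \<le> (\<bar>f x\<bar> * exp (a * x)) * exp (r * \<bar>x\<bar>)"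
        by (intro mult_left_mono) auto
      also have "\<dots> \<le> w x" using wb[of x] by (simp add: exp_add mult.assoc)
      finally show "norm (x * f x * exp (a * x)) \<le> norm (w x / r)"
        using r w0[of x] by (simp add: abs_mult field_simps)
    qed
  qed simp
  define Z where "Z t = (LINT x|M. f x * exp (t * x))" for t
  define D where "D = (LINT x|M. x * f x * exp (a * x))"
  \<comment> \<open>The factor \<open>8 / r\<^sup>2\<close> comes from
    \<open>v\<^sup>2 / 2 \<le> exp v\<close> at \<open>v = r / 2 * \<bar>x\<bar>\<close>. One half
    of \<open>r\<close> absorbs \<open>x\<^sup>2\<close> and the other half absorbs
    \<open>exp \<bar>t * x\<bar>\<close>, hence the restriction to
    \<open>\<bar>t\<bar> \<le> r / 2\<close>.\<close>
  define K where "K = (8 / r\<^sup>2) * (LINT x|M. w x)"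
  have bound: "\<bar>Z (a + t) - Z a - t * D\<bar> \<le> t\<^sup>2 * K" if t: "\<bar>t\<bar> \<le> r / 2" for t
  proof -
    have at: "a + t \<in> N" using mem t r by auto
    have eq: "Z (a + t) - Z a - t * D
        = (LINT x|M. f x * exp ((a + t) * x) - f x * exp (a * x) - t * (x * f x * exp (a * x)))"
      unfolding Z_def D_def using int[OF at] int[OF a] I by simp
    have "\<bar>f x * exp ((a + t) * x) - f x * exp (a * x) - t * (x * f x * exp (a * x))\<bar>
        \<le> t\<^sup>2 * (8 / r\<^sup>2) * w x" for x
    proof -
      have tx: "\<bar>t * x\<bar> \<le> (r / 2) * \<bar>x\<bar>" using mult_right_mono[OF t, of "\<bar>x\<bar>"] by (simp add: abs_mult)
      have "f x * exp ((a + t) * x) - f x * exp (a * x) - t * (x * f x * exp (a * x))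
          = f x * exp (a * x) * (exp (t * x) - 1 - t * x)"
        by (simp add: algebra_simps exp_add)
      then have "\<bar>f x * exp ((a + t) * x) - f x * exp (a * x) - t * (x * f x * exp (a * x))\<bar>
          = \<bar>f x\<bar> * exp (a * x) * \<bar>exp (t * x) - 1 - t * x\<bar>" by (simp add: abs_mult)
      also have "\<dots> \<le> \<bar>f x\<bar> * exp (a * x) * ((t * x)\<^sup>2 * exp \<bar>t * x\<bar>)"
        by (intro mult_left_mono exp_linear_remainder_le) auto
      also have "\<dots> \<le> \<bar>f x\<bar> * exp (a * x) * (t\<^sup>2 * ((8 / r\<^sup>2) * exp (r / 2 * \<bar>x\<bar>)) * exp (r / 2 * \<bar>x\<bar>))"
      proof -
        have "(r / 2 * \<bar>x\<bar>)\<^sup>2 / 2 \<le> exp (r / 2 * \<bar>x\<bar>)"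
        proof -
          have "1 + (r / 2 * \<bar>x\<bar>) + (r / 2 * \<bar>x\<bar>)\<^sup>2 / 2 \<le> exp (r / 2 * \<bar>x\<bar>)"
            using r by (intro exp_lower_Taylor_quadratic) auto
          moreover have "0 \<le> r / 2 * \<bar>x\<bar>" using r by simp
          ultimately show ?thesis by linarith
        qed
        then have "x\<^sup>2 \<le> (8 / r\<^sup>2) * exp (r / 2 * \<bar>x\<bar>)"
          using r by (simp add: field_simps power2_eq_square)
        then have "(t * x)\<^sup>2 \<le> t\<^sup>2 * ((8 / r\<^sup>2) * exp (r / 2 * \<bar>x\<bar>))"
          unfolding power_mult_distrib by (rule mult_left_mono) simp
        then show ?thesis using tx
          by (intro mult_left_mono mult_mono) auto
      qed
      also have "\<dots> = t\<^sup>2 * (8 / r\<^sup>2) * (\<bar>f x\<bar> * exp (a * x + r * \<bar>x\<bar>))"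
      proof -
        have "exp (r * \<bar>x\<bar>) = exp (r / 2 * \<bar>x\<bar>) * exp (r / 2 * \<bar>x\<bar>)"
          unfolding exp_add[symmetric] by simp
        then show ?thesis by (simp add: exp_add)
      qed
      also have "\<dots> \<le> t\<^sup>2 * (8 / r\<^sup>2) * w x"
        by (intro mult_left_mono wb) auto
      finally show ?thesis .
    qed
    then have "\<bar>Z (a + t) - Z a - t * D\<bar> \<le> (LINT x|M. t\<^sup>2 * (8 / r\<^sup>2) * w x)"
      unfolding eq using int[OF at] int[OF a] I iw
      by (intro order_trans[OF integral_abs_bound] integral_mono integrable_abs) auto
    then show ?thesis by (simp add: K_def)
  qed
  have "((\<lambda>t. (Z (a + t) - Z a) / t) \<longlongrightarrow> D) (at 0)"
  proof -
    have "((\<lambda>t. (Z (a + t) - Z a) / t - D) \<longlongrightarrow> 0) (at 0)"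
    proof (rule Lim_null_comparison)
      show "\<forall>\<^sub>F t in at 0. norm ((Z (a + t) - Z a) / t - D) \<le> \<bar>t\<bar> * K"
        unfolding eventually_at
      proof (intro exI[of _ "r / 2"] conjI ballI impI)
        fix t :: real assume "t \<noteq> 0 \<and> dist t 0 < r / 2"
        then have t: "t \<noteq> 0" "\<bar>t\<bar> \<le> r / 2" by auto
        have "norm ((Z (a + t) - Z a) / t - D) = \<bar>Z (a + t) - Z a - t * D\<bar> / \<bar>t\<bar>"
          using t unfolding real_norm_def abs_divide[symmetric] by (simp add: field_simps)
        also have "\<dots> \<le> t\<^sup>2 * K / \<bar>t\<bar>" by (intro divide_right_mono bound t) auto
        also have "\<dots> = \<bar>t\<bar> * K" using t by (simp add: power2_eq_square field_simps)
        finally show "norm ((Z (a + t) - Z a) / t - D) \<le> \<bar>t\<bar> * K" .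
      qed (use r in auto)
      show "((\<lambda>t. \<bar>t\<bar> * K) \<longlongrightarrow> 0) (at 0)" by (auto intro!: tendsto_eq_intros)
    qed
    then show ?thesis by (simp add: LIM_zero_iff)
  qed
  then show ?D unfolding DERIV_def Z_def D_def .
qed

section \<open>Partition integral and mean map of a regular family\<close>

definition partition_integral :: "real measure \<Rightarrow> (real \<Rightarrow> real) \<Rightarrow> real \<Rightarrow> real" where
  "partition_integral M h \<theta> = (LINT x|M. h x * exp (\<theta> * x))"

definition mean_parameter :: "real measure \<Rightarrow> (real \<Rightarrow> real) \<Rightarrow> real \<Rightarrow> real" where
  "mean_parameter M h \<theta> = (LINT x|M. x * h x * exp (\<theta> * x)) / partition_integral M h \<theta>"

locale regular_family =
  fixes M :: "real measure" and h :: "real \<Rightarrow> real"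
  assumes family: "regular_expfam M h"
begin

abbreviation "N \<equiv> natural_space M h"
abbreviation "Z \<equiv> partition_integral M h"
abbreviation "m \<equiv> mean_parameter M h"

lemma sets_M: "sets M = sets borel" and h_borel: "h \<in> borel_measurable borel"
  and h_nonneg: "0 \<le> h x" and open_N: "open N" and N_nonempty: "N \<noteq> {}"
  and not_concentrated: "\<not> (AE x in M. 0 < h x \<longrightarrow> x = c)"
  using family unfolding regular_expfam_def by auto

lemma h_measurable [measurable]: "h \<in> borel_measurable M"
  and id_measurable [measurable]: "(\<lambda>x. x) \<in> borel_measurable M"
  using h_borel by (auto simp: measurable_cong_sets[OF sets_M refl])

lemma integrable_0: "\<theta> \<in> N \<Longrightarrow> integrable M (\<lambda>x. h x * exp (\<theta> * x))"
  by (simp add: natural_space_def)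

lemma integrable_1: "\<theta> \<in> N \<Longrightarrow> integrable M (\<lambda>x. x * h x * exp (\<theta> * x))"
  by (rule integrable_exp_moment[OF sets_M h_borel open_N integrable_0])

text \<open>A vanishing integral would make \<open>h\<close> zero almost everywhere; the law would
  then be vacuously concentrated at 0, against minimality.\<close>

lemma Z_pos: assumes "\<theta> \<in> N" shows "0 < Z \<theta>"
proof -
  have "Z \<theta> \<noteq> 0"
  proof
    assume "Z \<theta> = 0"
    then have "AE x in M. h x * exp (\<theta> * x) = 0"
      using integrable_0[OF assms] h_nonneg
      by (subst (asm) partition_integral_def, subst (asm) integral_nonneg_eq_0_iff_AE) auto
    then have "AE x in M. 0 < h x \<longrightarrow> x = 0" by (rule AE_mp) auto
    then show False using not_concentrated by blast
  qed
  moreover have "0 \<le> Z \<theta>" using h_nonneg by (simp add: partition_integral_def)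
  ultimately show ?thesis by simp
qed

lemma DERIV_ln_Z:
  assumes "\<theta> \<in> N" shows "((\<lambda>t. ln (Z t)) has_real_derivative m \<theta>) (at \<theta>)"
proof -
  have "(Z has_real_derivative (LINT x|M. x * h x * exp (\<theta> * x))) (at \<theta>)"
    using DERIV_exp_moment[OF sets_M h_borel open_N integrable_0 assms]
    by (simp add: partition_integral_def[abs_def])
  then show ?thesis using Z_pos[OF assms]
    by (auto intro!: derivative_eq_intros simp: mean_parameter_def)
qed

text \<open>The numerator is itself differentiable, by the moment lemma with \<open>x * h x\<close>
  in place of \<open>h\<close>.\<close>

lemma continuous_on_mean: "continuous_on N m"
proof -
  have "isCont m \<theta>" if \<theta>: "\<theta> \<in> N" for \<theta>
  proof -
    have "isCont (\<lambda>t. LINT x|M. x * h x * exp (t * x)) \<theta>"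
      using h_borel
      by (intro DERIV_isCont[OF DERIV_exp_moment[OF sets_M _ open_N integrable_1 \<theta>]]) auto
    moreover have "isCont Z \<theta>"
      unfolding partition_integral_def[abs_def]
      by (rule DERIV_isCont[OF DERIV_exp_moment[OF sets_M h_borel open_N integrable_0 \<theta>]])
    ultimately show ?thesis using Z_pos[OF \<theta>]
      unfolding mean_parameter_def[abs_def] by (intro continuous_intros) auto
  qed
  then show ?thesis by (simp add: continuous_at_imp_continuous_on)
qed

text \<open>Strict convexity without second derivatives: integrate \<open>1 + u \<le> exp u\<close> at
  \<open>u = (\<theta> - t) * (x - m t)\<close> against the law with parameter \<open>t\<close>.\<close>

lemma ln_Z_strict:
  assumes \<theta>: "\<theta> \<in> N" and t: "t \<in> N" and ne: "\<theta> \<noteq> t"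
  shows "ln (Z t) + m t * (\<theta> - t) < ln (Z \<theta>)"
proof -
  define u where "u x = (\<theta> - t) * (x - m t)" for x
  \<comment> \<open>The nonnegative gap in \<open>1 + u \<le> exp u\<close>, weighted by the
    unnormalised density at \<open>t\<close>. Its integral has no linear term because
    \<open>m t\<close> is the mean at \<open>t\<close>.\<close>
  define k where "k x = h x * exp (t * x) * (exp (u x) - 1 - u x)" for x
  have k: "k x = exp (- (\<theta> - t) * m t) * (h x * exp (\<theta> * x)) - h x * exp (t * x)
      - (\<theta> - t) * (x * h x * exp (t * x)) + (\<theta> - t) * m t * (h x * exp (t * x))" for x
  proof -
    have "exp (t * x) * exp (u x) = exp (- (\<theta> - t) * m t) * exp (\<theta> * x)"
      unfolding exp_add[symmetric] u_def by (simp add: algebra_simps)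
    then have "k x = h x * (exp (- (\<theta> - t) * m t) * exp (\<theta> * x)) - h x * exp (t * x) * (1 + u x)"
      by (metis (no_types) k_def diff_diff_eq mult.assoc right_diff_distrib)
    then show ?thesis by (simp add: u_def algebra_simps)
  qed
  have ik: "integrable M k"
    unfolding k[abs_def] using integrable_0[OF \<theta>] integrable_0[OF t] integrable_1[OF t] by auto
  have "(LINT x|M. k x) = exp (- (\<theta> - t) * m t) * Z \<theta> - Z t
      - (\<theta> - t) * (LINT x|M. x * h x * exp (t * x)) + (\<theta> - t) * m t * Z t"
    unfolding k[abs_def] partition_integral_def
    using integrable_0[OF \<theta>] integrable_0[OF t] integrable_1[OF t] by simp
  also have "(LINT x|M. x * h x * exp (t * x)) = m t * Z t"
    using Z_pos[OF t] by (simp add: mean_parameter_def)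
  finally have Ik: "(LINT x|M. k x) = exp (- (\<theta> - t) * m t) * Z \<theta> - Z t" by simp
  have k0: "0 \<le> k x" for x
    unfolding k_def using h_nonneg[of x] exp_ge_add_one_self[of "u x"]
    by (intro mult_nonneg_nonneg) (linarith | simp)+
  \<comment> \<open>Equality in \<open>1 + u \<le> exp u\<close> forces \<open>u = 0\<close>, so a
    zero integral would concentrate the law at \<open>m t\<close>.\<close>
  have "(LINT x|M. k x) \<noteq> 0"
  proof
    assume "(LINT x|M. k x) = 0"
    then have "AE x in M. k x = 0"
      using integral_nonneg_eq_0_iff_AE[OF ik] k0 by simp
    moreover have "0 < h x \<longrightarrow> x = m t" if "k x = 0" for x
    proof (rule impI, rule ccontr)
      assume "0 < h x" "x \<noteq> m t"
      then have "u x \<noteq> 0" using ne by (simp add: u_def)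
      then have "exp (u x) - 1 - u x \<noteq> 0" using ln_eq_minus_one[of "exp (u x)"] by auto
      then show False using that \<open>0 < h x\<close> by (simp add: k_def)
    qed
    ultimately have "AE x in M. 0 < h x \<longrightarrow> x = m t" by (auto elim!: AE_mp)
    then show False using not_concentrated by blast
  qed
  moreover have "0 \<le> (LINT x|M. k x)" using k0 by simp
  ultimately have "Z t < exp (- (\<theta> - t) * m t) * Z \<theta>" using Ik by simp
  then have "ln (Z t) < ln (exp (- (\<theta> - t) * m t) * Z \<theta>)"
    using Z_pos[OF t] Z_pos[OF \<theta>] by (subst ln_less_cancel_iff) auto
  also have "\<dots> = - (\<theta> - t) * m t + ln (Z \<theta>)"
    using Z_pos[OF \<theta>] by (simp add: ln_mult)
  finally show ?thesis by (simp add: algebra_simps)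
qed

lemma ln_Z_ge:
  assumes "\<theta> \<in> N" "t \<in> N"
  shows "ln (Z t) + m t * (\<theta> - t) \<le> ln (Z \<theta>)"
  using ln_Z_strict[OF assms] by (cases "\<theta> = t") auto

text \<open>Add the tangent inequality at \<open>s\<close>, evaluated at \<open>t\<close>, to the
  one at \<open>t\<close>, evaluated at \<open>s\<close>.\<close>

lemma mean_mono: assumes "s \<in> N" "t \<in> N" "s \<le> t" shows "m s \<le> m t"
proof (cases "s = t")
  case False
  have "(m s - m t) * (t - s) \<le> 0"
    using ln_Z_ge[OF assms(1,2)] ln_Z_ge[OF assms(2,1)] by (simp add: algebra_simps)
  then show ?thesis using False assms by (simp add: mult_le_0_iff)
qed simp

text \<open>Steepness: the mean cannot converge at a finite endpoint of the natural parameter space,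
  because the partition integral would stay bounded and the endpoint would belong to the space.\<close>

lemma limit_point_of_convergent_mean:
  assumes nt: "K \<noteq> bot" and K: "eventually (\<lambda>i. t i \<in> N) K"
    and lim: "(t \<longlongrightarrow> a) K" and mlim: "((\<lambda>i. m (t i)) \<longlongrightarrow> c) K"
  shows "a \<in> N"
proof -
  obtain r where r: "r \<in> N" using N_nonempty by auto
  \<comment> \<open>The tangent at \<open>t i\<close>, evaluated at the reference point
    \<open>r\<close>, bounds \<open>ln (Z (t i))\<close> by a quantity converging to
    \<open>ln (Z r) - c * (r - a)\<close>; the summand 1 is slack.\<close>
  define B where "B = exp (ln (Z r) - c * (r - a) + 1)"
  have "((\<lambda>i. ln (Z r) - m (t i) * (r - t i)) \<longlongrightarrow> ln (Z r) - c * (r - a)) K"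
    by (intro tendsto_intros lim mlim)
  then have "eventually (\<lambda>i. ln (Z r) - m (t i) * (r - t i) < ln (Z r) - c * (r - a) + 1) K"
    by (rule order_tendstoD) simp
  then have ev: "eventually (\<lambda>i. t i \<in> N \<and> Z (t i) \<le> B) K"
    using K
  proof eventually_elim
    case (elim i)
    have "ln (Z (t i)) \<le> ln (Z r) - m (t i) * (r - t i)" using ln_Z_ge[OF r] elim by force
    then have "ln (Z (t i)) \<le> ln B" using elim by (simp add: B_def)
    moreover have "0 < B" by (simp add: B_def)
    ultimately show ?case using elim Z_pos[of "t i"] by simp
  qed
  \<comment> \<open>Fatou's lemma below is about sequences, so one that converges to
    \<open>a\<close> is extracted from the arbitrary filter.\<close>
  have "\<exists>i. (t i \<in> N \<and> Z (t i) \<le> B) \<and> dist (t i) a < inverse (real (Suc n))" for n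
  proof -
    have "eventually (\<lambda>i. dist (t i) a < inverse (real (Suc n))) K"
      by (rule tendstoD[OF lim]) simp
    from eventually_happens'[OF nt eventually_conj[OF ev this]] show ?thesis .
  qed
  then obtain i where i: "\<And>n. t (i n) \<in> N" "\<And>n. Z (t (i n)) \<le> B"
      "\<And>n. dist (t (i n)) a < inverse (real (Suc n))" by metis
  have lim': "(\<lambda>n. t (i n)) \<longlonglongrightarrow> a"
    by (rule metric_tendsto_imp_tendsto[OF LIMSEQ_inverse_real_of_nat])
       (use i(3) in \<open>auto intro!: always_eventually simp: less_imp_le\<close>)
  have "(\<integral>\<^sup>+ x. ennreal (h x * exp (a * x)) \<partial>M)
      = (\<integral>\<^sup>+ x. liminf (\<lambda>n. ennreal (h x * exp (t (i n) * x))) \<partial>M)"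
  proof (intro nn_integral_cong)
    fix x
    have "(\<lambda>n. ennreal (h x * exp (t (i n) * x))) \<longlonglongrightarrow> ennreal (h x * exp (a * x))"
      by (intro tendsto_intros lim')
    then show "ennreal (h x * exp (a * x)) = liminf (\<lambda>n. ennreal (h x * exp (t (i n) * x)))"
      by (simp add: lim_imp_Liminf)
  qed
  also have "\<dots> \<le> liminf (\<lambda>n. \<integral>\<^sup>+ x. ennreal (h x * exp (t (i n) * x)) \<partial>M)"
    by (intro nn_integral_liminf) measurable
  also have "\<dots> \<le> ennreal B"
  proof (rule Liminf_le)
    show "sequentially \<noteq> bot" by simp
  next
    show "\<forall>\<^sub>F n in sequentially. (\<integral>\<^sup>+ x. ennreal (h x * exp (t (i n) * x)) \<partial>M) \<le> ennreal B"
    proof (rule always_eventually, rule allI)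
      fix n
      have "(\<integral>\<^sup>+ x. ennreal (h x * exp (t (i n) * x)) \<partial>M) = ennreal (Z (t (i n)))"
        unfolding partition_integral_def using h_nonneg
        by (intro nn_integral_eq_integral integrable_0 i) auto
      then show "(\<integral>\<^sup>+ x. ennreal (h x * exp (t (i n) * x)) \<partial>M) \<le> ennreal B"
        using i(2) by (simp add: ennreal_leI)
    qed
  qed
  finally have "(\<integral>\<^sup>+ x. ennreal (h x * exp (a * x)) \<partial>M) < \<infinity>"
    by (rule le_less_trans) simp
  then have "integrable M (\<lambda>x. h x * exp (a * x))"
    using h_nonneg by (intro integrableI_nonneg) auto
  then show ?thesis by (simp add: natural_space_def)
qed

end

subsection \<open>Legendre generators\<close>

text \<open>Makes the definite description usable: two gradients induce the same functional, and
  testing it on their difference shows that they agree. Only the values on an open neighbourhood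
  matter, so \<open>H\<close> may be infinite elsewhere.\<close>

lemma gradient_eq:
  assumes S: "open S" "v \<in> S" and eq: "\<And>u. u \<in> S \<Longrightarrow> real_of_ereal (H u) = f u"
    and D: "GDERIV f v :> D"
  shows "gradient H v = D"
proof -
  have D': "GDERIV (\<lambda>u. real_of_ereal (H u)) v :> D"
    unfolding gderiv_def
    by (rule has_derivative_transform_within_open[OF D[unfolded gderiv_def] S]) (simp add: eq)
  have "D2 = D" if "GDERIV (\<lambda>u. real_of_ereal (H u)) v :> D2" for D2
  proof -
    have "(\<lambda>h. h \<bullet> D2) = (\<lambda>h. h \<bullet> D)"
      using that D' unfolding gderiv_def by (rule has_derivative_unique)
    from fun_cong[OF this, of "D2 - D"] have "(D2 - D) \<bullet> (D2 - D) = 0"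
      by (simp add: inner_diff_right)
    then show ?thesis by simp
  qed
  then show ?thesis unfolding gradient_def using D' by (intro the_equality)
qed

text \<open>Interface between extended-valued \<open>F\<close> and real calculus: \<open>f\<close>
  is its finite part, \<open>g\<close> the gradient, and strict convexity enters as a strict tangent
  inequality.\<close>

locale legendre_generator =
  fixes F :: "'a::euclidean_space \<Rightarrow> ereal" and f :: "'a \<Rightarrow> real" and g :: "'a \<Rightarrow> 'a" and S :: "'a set"
  assumes open_S: "open S" and nonempty: "S \<noteq> {}"
    and F_eq: "F u = (if u \<in> S then ereal (f u) else \<infinity>)"
    and deriv: "u \<in> S \<Longrightarrow> GDERIV f u :> g u"
    and strict: "u \<in> S \<Longrightarrow> v \<in> S \<Longrightarrow> u \<noteq> v \<Longrightarrow> f v + g v \<bullet> (u - v) < f u"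
    and cont: "continuous_on S g"
begin

lemma ge: "u \<in> S \<Longrightarrow> v \<in> S \<Longrightarrow> f v + g v \<bullet> (u - v) \<le> f u"
  using strict[of u v] by (cases "u = v") auto

lemma gradient_F: "v \<in> S \<Longrightarrow> gradient F v = g v"
  by (rule gradient_eq[OF open_S _ _ deriv]) (auto simp: F_eq)

text \<open>Everything except \<open>F u\<close> is gathered into one real number, so the formula
  also covers \<open>u\<close> outside the effective domain.\<close>

lemma bregman_F:
  assumes "v \<in> S"
  shows "bregman F u v = F u + ereal (- f v - g v \<bullet> (u - v))"
  using assms by (cases "u \<in> S") (auto simp: bregman_def gradient_F F_eq)

lemma bregman_F_pos:
  assumes "v \<in> S" "u \<noteq> v"
  shows "0 < bregman F u v"
  using strict[of u v] assms by (cases "u \<in> S") (auto simp: bregman_F F_eq zero_ereal_def)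

text \<open>With equal gradients, the two strict tangent inequalities between \<open>u\<close> and
  \<open>v\<close> contradict each other.\<close>

lemma inj_on_g: "inj_on g S"
proof (rule inj_onI, rule ccontr)
  fix u v assume uv: "u \<in> S" "v \<in> S" "g u = g v" "u \<noteq> v"
  then show False using strict[of u v] strict[of v u] by (simp add: inner_diff_right)
qed

lemma conjugate_ge: "v \<in> S \<Longrightarrow> ereal (y \<bullet> v - f v) \<le> convex_conjugate F y"
  unfolding convex_conjugate_def by (rule SUP_upper2[of v]) (auto simp: F_eq)

lemma conjugate_le:
  assumes "\<And>v. v \<in> S \<Longrightarrow> ereal (y \<bullet> v - f v) \<le> c"
  shows "convex_conjugate F y \<le> c"
  unfolding convex_conjugate_def using assms by (intro SUP_least) (auto simp: F_eq)

lemma conjugate_not_minf: "convex_conjugate F y \<noteq> - \<infinity>"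
  using nonempty conjugate_ge[of _ y] by fastforce

text \<open>Equality case of Fenchel-Young: the tangent inequality at \<open>u\<close> says that
  \<open>u\<close> attains the supremum.\<close>

lemma conjugate_gradient:
  assumes "u \<in> S" shows "convex_conjugate F (g u) = ereal (g u \<bullet> u - f u)"
proof (rule antisym)
  show "convex_conjugate F (g u) \<le> ereal (g u \<bullet> u - f u)"
    using ge[OF _ assms] by (intro conjugate_le) (force simp: inner_diff_right)
qed (rule conjugate_ge[OF assms])

text \<open>Subgradient inequalities at \<open>g u\<close> and at \<open>w\<close> squeeze the first-order remainder between 0 and
  \<open>(T w - u) \<bullet> (w - g u)\<close>, where the inverse \<open>T\<close> of \<open>g\<close> is continuous by invariance of domain.\<close>

lemma gradient_conjugate:
  assumes u: "u \<in> S" shows "gradient (convex_conjugate F) (g u) = u"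
proof -
  have op: "open (g ` S)" by (rule invariance_of_domain[OF cont open_S inj_on_g])
  obtain T where T: "homeomorphism S (g ` S) g T"
    using invariance_of_domain_homeomorphism[OF open_S cont _ inj_on_g] by auto
  define c where "c w = real_of_ereal (convex_conjugate F w)" for w
  have c: "c (g v) = g v \<bullet> v - f v" if "v \<in> S" for v
    using that by (simp add: c_def conjugate_gradient)
  have T_in: "T w \<in> S" and gT: "g (T w) = w" if "w \<in> g ` S" for w
    using T that by (auto simp: homeomorphism_def)
  have Tg: "T (g u) = u" using T u by (auto simp: homeomorphism_def)
  have "isCont T (g u)"
    using T u op by (auto simp: homeomorphism_def continuous_on_eq_continuous_at)
  then have Tlim: "((\<lambda>w. norm (T w - u)) \<longlongrightarrow> 0) (at (g u))"
    by (auto simp: isCont_def Tg intro!: tendsto_norm_zero LIM_zero)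
  have rem: "norm ((c w - c (g u) - (w - g u) \<bullet> u) /\<^sub>R norm (w - g u)) \<le> norm (T w - u)"
    if w: "w \<in> g ` S" "w \<noteq> g u" for w
  proof -
    have cw: "c w = w \<bullet> T w - f (T w)" using c[OF T_in[OF w(1)]] gT[OF w(1)] by simp
    have lo: "0 \<le> c w - c (g u) - (w - g u) \<bullet> u"
      using ge[OF u T_in[OF w(1)]] unfolding cw c[OF u] gT[OF w(1)]
      by (simp add: inner_diff_right inner_diff_left)
    have "c w - c (g u) - (w - g u) \<bullet> u \<le> (w - g u) \<bullet> (T w - u)"
      using ge[OF T_in[OF w(1)] u] unfolding cw c[OF u]
      by (simp add: inner_diff_right inner_diff_left)
    also have "\<dots> \<le> norm (w - g u) * norm (T w - u)" by (rule norm_cauchy_schwarz)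
    finally show ?thesis using lo w(2) by (simp add: field_simps)
  qed
  have "GDERIV c (g u) :> u"
    unfolding gderiv_def has_derivative_at_within
  proof (rule conjI[rotated])
    show "((\<lambda>w. (c w - c (g u) - (w - g u) \<bullet> u) /\<^sub>R norm (w - g u)) \<longlongrightarrow> 0) (at (g u))"
    proof (rule Lim_null_comparison[OF _ Tlim])
      have "eventually (\<lambda>w. w \<in> g ` S) (at (g u))"
        using op u by (intro eventually_at_in_open') auto
      then show "eventually (\<lambda>w. norm ((c w - c (g u) - (w - g u) \<bullet> u) /\<^sub>R norm (w - g u))
          \<le> norm (T w - u)) (at (g u))"
        unfolding eventually_at_filter by eventually_elim (use rem in auto)
    qed
  qed (rule bounded_linear_inner_left)
  then show ?thesis
    by (intro gradient_eq[OF op]) (use u in \<open>auto simp: c_def\<close>)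
qed

text \<open>The gradient at \<open>g u\<close> is \<open>u\<close>, so the
  \<open>g u \<bullet> u\<close> terms cancel and the Fenchel-Young gap remains. The conjugate may
  be infinite at \<open>w\<close>.\<close>

lemma bregman_conjugate:
  assumes "u \<in> S"
  shows "bregman (convex_conjugate F) w (g u) = convex_conjugate F w + ereal (f u - w \<bullet> u)"
proof -
  have "convex_conjugate F w + ereal (- (g u \<bullet> u - f u) - u \<bullet> (w - g u)) =
      bregman (convex_conjugate F) w (g u)"
    using assms conjugate_not_minf[of w]
    by (cases "convex_conjugate F w") (auto simp: bregman_def gradient_conjugate conjugate_gradient)
  then show ?thesis by (simp add: inner_diff_right inner_commute)
qed

lemma bregman_duality:
  assumes "u \<in> S" "v \<in> S"
  shows "bregman (convex_conjugate F) (g u) (g v) = bregman F v u"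
  using assms by (simp add: bregman_conjugate bregman_F conjugate_gradient F_eq inner_diff_right)

text \<open>At a possibly infinite limit point of \<open>S\<close>, the conjugate value at \<open>y\<close> is still approached. Concavity of
  \<open>\<lambda>t. y \<bullet> t - f t\<close>, whose gradient \<open>y - g t\<close> tends to 0, reduces this to an estimate of the first-order terms.\<close>

lemma tendsto_at_saturation:
  assumes fin: "convex_conjugate F y = ereal c"
    and K: "eventually (\<lambda>t. t \<in> S) K" and lim: "(g \<longlongrightarrow> y) K"
    and small: "\<And>u e. u \<in> S \<Longrightarrow> 0 < e \<Longrightarrow> eventually (\<lambda>t. (y - g t) \<bullet> (u - t) < e) K"
  shows tendsto_conjugate: "((\<lambda>t. y \<bullet> t - f t) \<longlongrightarrow> c) K"
    and tendsto_first_order: "((\<lambda>t. (y - g t) \<bullet> (u - t)) \<longlongrightarrow> 0) K"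
proof -
  have up: "y \<bullet> t - f t \<le> c" if "t \<in> S" for t
    using conjugate_ge[OF that, of y] fin by simp
  have near: "\<exists>t\<in>S. c - e < y \<bullet> t - f t" if "0 < e" for e
  proof (rule ccontr)
    assume "\<not> ?thesis"
    then have "convex_conjugate F y \<le> ereal (c - e)" by (intro conjugate_le) force
    then show False using fin that by simp
  qed
  have concave: "y \<bullet> u - f u \<le> y \<bullet> t - f t + (y - g t) \<bullet> (u - t)" if "u \<in> S" "t \<in> S" for u t
    using ge[OF that] by (simp add: inner_diff_left inner_diff_right)
  show "((\<lambda>t. y \<bullet> t - f t) \<longlongrightarrow> c) K"
  proof (rule tendstoI)
    fix e :: real assume e: "0 < e"
    \<comment> \<open>A nearly optimal \<open>u\<close> bounds the objective at \<open>t\<close>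
      from below through the tangent inequality; the conjugate bounds it from above.\<close>
    obtain u where u: "u \<in> S" "c - e / 2 < y \<bullet> u - f u" using near[of "e / 2"] e by auto
    have "eventually (\<lambda>t. (y - g t) \<bullet> (u - t) < e / 2) K" using small[OF u(1), of "e / 2"] e by simp
    with K show "eventually (\<lambda>t. dist (y \<bullet> t - f t) c < e) K"
    proof eventually_elim
      case (elim t)
      then show ?case using concave[OF u(1), of t] up[of t] u e by (simp add: dist_real_def)
    qed
  qed
  have g0: "((\<lambda>t. (y - g t) \<bullet> w) \<longlongrightarrow> 0) K" for w
    using tendsto_inner[OF tendsto_diff[OF tendsto_const lim] tendsto_const, of y w] by simp
  have base: "((\<lambda>t. (y - g t) \<bullet> (v - t)) \<longlongrightarrow> 0) K" if v: "v \<in> S" for v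
  proof (rule tendstoI)
    fix e :: real assume e: "0 < e"
    \<comment> \<open>Hypothesis \<open>small\<close> bounds the term only from above. At a nearly
      optimal \<open>w\<close>, concavity bounds \<open>(y - g t) \<bullet> (w - t)\<close> from
      below, and replacing \<open>w\<close> by \<open>v\<close> costs a term that tends to
      0.\<close>
    obtain w where w: "w \<in> S" "c - e / 2 < y \<bullet> w - f w" using near[of "e / 2"] e by auto
    have "eventually (\<lambda>t. \<bar>(y - g t) \<bullet> (v - w)\<bar> < e / 2) K"
      using tendstoD[OF g0[of "v - w"], of "e / 2"] e by simp
    moreover have "eventually (\<lambda>t. (y - g t) \<bullet> (v - t) < e) K" using small[OF v e] .
    ultimately show "eventually (\<lambda>t. dist ((y - g t) \<bullet> (v - t)) 0 < e) K"
      using K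
    proof eventually_elim
      case (elim t)
      have "(y - g t) \<bullet> (v - t) = (y - g t) \<bullet> (v - w) + (y - g t) \<bullet> (w - t)"
        by (simp add: inner_diff_right)
      then show ?case using elim concave[OF w(1), of t] up[of t] w(2) by (simp add: dist_real_def)
    qed
  qed
  obtain v where v: "v \<in> S" using nonempty by auto
  \<comment> \<open>Here \<open>u\<close> may lie outside \<open>S\<close>: the shift from
    \<open>v\<close> to \<open>u\<close> is a fixed vector paired with \<open>y - g t\<close>, which
    tends to 0.\<close>
  show "((\<lambda>t. (y - g t) \<bullet> (u - t)) \<longlongrightarrow> 0) K"
    using tendsto_add[OF base[OF v] g0[of "u - v"]] by (simp add: inner_diff_right)
qed

end

subsection \<open>Saturated parameters and the likelihood\<close>

definition total_log_partition :: "real measure \<Rightarrow> (real \<Rightarrow> real) \<Rightarrow> real ^ 'n \<Rightarrow> real" where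
  "total_log_partition M h \<theta> = (\<Sum>i\<in>UNIV. ln (partition_integral M h (\<theta> $ i)))"

definition mean_vector :: "real measure \<Rightarrow> (real \<Rightarrow> real) \<Rightarrow> real ^ 'n \<Rightarrow> real ^ 'n" where
  "mean_vector M h \<theta> = (\<chi> i. mean_parameter M h (\<theta> $ i))"

lemma inj_embed: "inj embed"
  by (auto simp: inj_def embed_def vec_eq_iff)

text \<open>Uniqueness comes from injectivity of \<open>embed\<close> for literal values, and from
  the proper filter and Hausdorff separation for limits.\<close>

lemma extended_value_eq:
  fixes l :: "'b::t2_space"
  assumes "has_extended_value S f s l"
  shows "extended_value S f s = l"
  unfolding extended_value_def
proof (rule the_equality)
  show "has_extended_value S f s l" by (rule assms)
next
  fix l' assume "has_extended_value S f s l'"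
  then show "l' = l"
    using assms
    by (auto simp: has_extended_value_def inj_eq[OF inj_embed] intro: tendsto_unique split: if_splits)
qed

lemma eventually_toward: "eventually (\<lambda>t. t \<in> S) (toward S s)"
  by (simp add: toward_def eventually_inf_principal)

lemma toward_component: "((\<lambda>t. ereal (t $ i)) \<longlongrightarrow> s $ i) (toward S s)"
proof -
  have "(embed \<longlongrightarrow> s) (toward S s)"
    unfolding toward_def by (rule filterlim_mono[OF filterlim_filtercomap order_refl inf_le1])
  from tendsto_vec_nth[OF this, of i] show ?thesis by (simp add: embed_def)
qed

context regular_family
begin

lemma total_cumulant_eq:
  "total_cumulant M h \<theta>
     = (if \<theta> \<in> natural_domain M h then ereal (total_log_partition M h \<theta>) else \<infinity>)"
proof (cases "\<theta> \<in> natural_domain M h")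
  case True
  then show ?thesis
    by (simp add: total_cumulant_def total_log_partition_def natural_domain_def cumulant_def
        partition_integral_def)
next
  case False
  then obtain i where "cumulant M h (\<theta> $ i) = \<infinity>"
    by (auto simp: natural_domain_def cumulant_def)
  then have "total_cumulant M h \<theta> = \<infinity>"
    unfolding total_cumulant_def by (subst sum_Pinfty) (auto intro: exI[of _ i])
  with False show ?thesis by simp
qed

lemma log_likelihood_eq:
  fixes y \<theta> :: "real ^ 'n"
  assumes "\<And>i. 0 < h (y $ i)"
  shows "log_likelihood M h y \<theta> =
    (if \<theta> \<in> natural_domain M h
     then ereal (y \<bullet> \<theta> - total_log_partition M h \<theta> + (\<Sum>i\<in>UNIV. ln (h (y $ i)))) else - \<infinity>)"
proof (cases "\<theta> \<in> natural_domain M h")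
  case True
  have "ln (\<Prod>i\<in>UNIV. expfam_density M h (\<theta> $ i) (y $ i))
      = (\<Sum>i\<in>UNIV. ln (expfam_density M h (\<theta> $ i) (y $ i)))"
    using assms by (intro ln_prod) (auto simp: expfam_density_def less_imp_neq[symmetric])
  also have "\<dots> = (\<Sum>i\<in>UNIV. ln (h (y $ i)) + (\<theta> $ i * y $ i - ln (Z (\<theta> $ i))))"
    using True assms
    by (intro sum.cong refl)
       (simp add: less_imp_neq[symmetric] expfam_density_def ln_mult natural_domain_def cumulant_def
          partition_integral_def)
  finally show ?thesis using True
    by (simp add: log_likelihood_def total_log_partition_def inner_vec_def sum.distrib sum_subtractf
        mult.commute)
qed (simp add: log_likelihood_def)

text \<open>The domain is a box and \<open>F\<close> a sum over coordinates, so the scalar facts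
  transfer; strictness needs just one coordinate where the two points differ.\<close>

lemma legendre_total_cumulant:
  "legendre_generator (total_cumulant M h) (total_log_partition M h) (mean_vector M h)
     (natural_domain M h :: (real ^ 'n) set)"
proof
  show "open (natural_domain M h :: (real ^ 'n) set)"
    unfolding natural_domain_def using open_N by (intro open_vector_box) simp
  obtain r where "r \<in> N" using N_nonempty by auto
  then have "(\<chi> i. r) \<in> (natural_domain M h :: (real ^ 'n) set)" by (simp add: natural_domain_def)
  then show "(natural_domain M h :: (real ^ 'n) set) \<noteq> {}" by blast
next
  fix u :: "real ^ 'n"
  show "total_cumulant M h u
     = (if u \<in> natural_domain M h then ereal (total_log_partition M h u) else \<infinity>)"
    by (rule total_cumulant_eq)
next
  fix u :: "real ^ 'n" assume u: "u \<in> natural_domain M h"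
  have "((\<lambda>u. ln (Z (u $ i))) has_derivative (\<lambda>d. d $ i * m (u $ i))) (at u)" for i
  proof -
    have "((\<lambda>t. ln (Z t)) has_derivative (*) (m (u $ i))) (at (u $ i))"
      using DERIV_ln_Z[of "u $ i"] u by (simp add: natural_domain_def has_field_derivative_def)
    from has_derivative_compose[OF bounded_linear_imp_has_derivative[OF bounded_linear_vec_nth] this]
    show ?thesis by (simp add: mult.commute)
  qed
  then show "GDERIV (total_log_partition M h) u :> mean_vector M h u"
    unfolding gderiv_def total_log_partition_def[abs_def] mean_vector_def inner_vec_def
    by (auto intro!: has_derivative_sum)
next
  fix u v :: "real ^ 'n"
  assume uv: "u \<in> natural_domain M h" "v \<in> natural_domain M h" "u \<noteq> v"
  then obtain i where "u $ i \<noteq> v $ i" by (auto simp: vec_eq_iff)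
  then have "(\<Sum>i\<in>UNIV. ln (Z (v $ i)) + m (v $ i) * (u $ i - v $ i)) < (\<Sum>i\<in>UNIV. ln (Z (u $ i)))"
    using uv by (intro sum_strict_mono_ex1) (auto simp: natural_domain_def ln_Z_ge intro!: ln_Z_strict)
  then show "total_log_partition M h v + mean_vector M h v \<bullet> (u - v) < total_log_partition M h u"
    by (simp add: total_log_partition_def mean_vector_def inner_vec_def sum.distrib)
next
  show "continuous_on (natural_domain M h) (mean_vector M h :: real ^ 'n \<Rightarrow> _)"
    unfolding mean_vector_def
    by (intro continuous_on_vec_lambda continuous_on_compose2[OF continuous_on_mean] continuous_intros)
       (auto simp: natural_domain_def)
qed

section \<open>The saturated parameter outside the natural domain\<close>

context
  fixes y :: "real ^ 'n" and s :: "ereal ^ 'n"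
  assumes saturated: "saturated_parameter M h y s"
    and boundary: "s \<notin> embed ` natural_domain M h"
begin

private abbreviation "K \<equiv> toward (natural_domain M h) s"

interpretation legendre_generator "total_cumulant M h" "total_log_partition M h" "mean_vector M h"
    "natural_domain M h :: (real ^ 'n) set"
  by (rule legendre_total_cumulant)

lemma toward_proper: "K \<noteq> bot"
  using saturated boundary by (simp add: saturated_parameter_def has_extended_value_def)

lemma mean_vector_tendsto: "(mean_vector M h \<longlongrightarrow> y) K"
proof -
  have "(gradient (total_cumulant M h) \<longlongrightarrow> y) K"
    using saturated boundary by (simp add: saturated_parameter_def has_extended_value_def)
  moreover have "eventually (\<lambda>t. gradient (total_cumulant M h) t = mean_vector M h t) K"
    using eventually_toward by (rule eventually_mono) (rule gradient_F)
  ultimately show ?thesis by (simp add: tendsto_cong)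
qed

lemma mean_tendsto: "((\<lambda>t. m (t $ i)) \<longlongrightarrow> y $ i) K"
  using tendsto_vec_nth[OF mean_vector_tendsto, of i] by (simp add: mean_vector_def)

lemma component_in_N: "eventually (\<lambda>t. t $ i \<in> N) K"
  using eventually_toward by (rule eventually_mono) (simp add: natural_domain_def)

text \<open>If all coordinates of \<open>s\<close> were finite, steepness would place each of them
  in the natural space, and \<open>s\<close> would be an embedded point of the domain.\<close>

lemma some_infinite: "\<exists>i. \<bar>s $ i\<bar> = \<infinity>"
proof (rule ccontr)
  assume "\<not> ?thesis"
  then have s: "s $ i = ereal (real_of_ereal (s $ i))" for i by (simp add: ereal_real')
  have "real_of_ereal (s $ i) \<in> N" for i
  proof (rule limit_point_of_convergent_mean[OF toward_proper component_in_N _ mean_tendsto])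
    show "((\<lambda>t. t $ i) \<longlongrightarrow> real_of_ereal (s $ i)) K"
      using toward_component[of i s] s[of i] by (metis lim_ereal)
  qed
  moreover have "s = embed (\<chi> i. real_of_ereal (s $ i))"
    using s by (simp add: embed_def vec_eq_iff)
  ultimately have "s \<in> embed ` natural_domain M h" by (auto simp: natural_domain_def)
  then show False using boundary by simp
qed

text \<open>At a finite limit the product tends to 0. At an infinite one, monotonicity makes
  \<open>y $ i\<close> a one-sided bound for the mean, so the two factors eventually have opposite
  signs or vanish.\<close>

lemma first_order_component:
  assumes a: "a \<in> N" and e: "0 < e"
  shows "eventually (\<lambda>t. (y $ i - m (t $ i)) * (a - t $ i) < e) K"
proof (cases "s $ i")
  case (real r)
  have "((\<lambda>t. t $ i) \<longlongrightarrow> r) K"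
    using toward_component[of i s] real by simp
  then have "((\<lambda>t. (y $ i - m (t $ i)) * (a - t $ i)) \<longlongrightarrow> (y $ i - y $ i) * (a - r)) K"
    by (intro tendsto_intros mean_tendsto)
  then show ?thesis using e by (auto dest: order_tendstoD(2))
next
  case PInf
  have large: "eventually (\<lambda>t. b < t $ i) K" for b
    using order_tendstoD(1)[OF toward_component[of i s], of "ereal b"] PInf by simp
  have le: "m b \<le> y $ i" if "b \<in> N" for b
  proof (rule tendsto_lowerbound[OF mean_tendsto _ toward_proper])
    show "eventually (\<lambda>t. m b \<le> m (t $ i)) K"
      using large[of b] component_in_N[of i] by eventually_elim (use that mean_mono in auto)
  qed
  show ?thesis using large[of a] component_in_N[of i]
  proof eventually_elim
    case (elim t)
    then have "(y $ i - m (t $ i)) * (a - t $ i) \<le> 0"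
      using le by (intro mult_nonneg_nonpos) auto
    then show ?case using e by linarith
  qed
next
  case MInf
  have small: "eventually (\<lambda>t. t $ i < b) K" for b
    using order_tendstoD(2)[OF toward_component[of i s], of "ereal b"] MInf by simp
  have ge: "y $ i \<le> m b" if "b \<in> N" for b
  proof (rule tendsto_upperbound[OF mean_tendsto _ toward_proper])
    show "eventually (\<lambda>t. m (t $ i) \<le> m b) K"
      using small[of b] component_in_N[of i] by eventually_elim (use that mean_mono in auto)
  qed
  show ?thesis using small[of a] component_in_N[of i]
  proof eventually_elim
    case (elim t)
    then have "(y $ i - m (t $ i)) * (a - t $ i) \<le> 0"
      using ge by (intro mult_nonpos_nonneg) auto
    then show ?case using e by linarith
  qed
qed

lemma first_order_small:
  assumes u: "u \<in> natural_domain M h" and e: "0 < e"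
  shows "eventually (\<lambda>t. (y - mean_vector M h t) \<bullet> (u - t) < e) K"
proof -
  have "eventually (\<lambda>t. \<forall>i. (y $ i - m (t $ i)) * (u $ i - t $ i) < e / CARD('n)) K"
    using u e by (intro eventually_all_finite first_order_component) (auto simp: natural_domain_def)
  then show ?thesis
  proof eventually_elim
    case (elim t)
    have "(y - mean_vector M h t) \<bullet> (u - t) = (\<Sum>i\<in>UNIV. (y $ i - m (t $ i)) * (u $ i - t $ i))"
      by (simp add: inner_vec_def mean_vector_def)
    also have "\<dots> < (\<Sum>i\<in>(UNIV :: 'n set). e / CARD('n))"
      using elim by (intro sum_strict_mono) auto
    finally show ?case by simp
  qed
qed

end

text \<open>Gives literal and limiting values the same form, with \<open>c\<close> the conjugate at
  \<open>y\<close>. Off the domain some coordinate of \<open>s\<close> is infinite, which is exactly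
  when \<open>fin\<close> supplies finiteness of \<open>c\<close>.\<close>

lemma saturated_values:
  fixes y :: "real ^ 'n"
  assumes sat: "saturated_parameter M h y s" and response: "\<And>i. 0 < h (y $ i)"
    and fin: "(\<exists>i. \<bar>s $ i\<bar> = \<infinity>) \<Longrightarrow> convex_conjugate (total_cumulant M h) y \<noteq> \<infinity>"
  obtains c where "convex_conjugate (total_cumulant M h) y = ereal c"
    "\<And>\<theta>. bregman_to_saturated M h \<theta> s = total_cumulant M h \<theta> + ereal (c - y \<bullet> \<theta>)"
    "extended_value (natural_domain M h) (log_likelihood M h y) s
       = ereal (c + (\<Sum>i\<in>UNIV. ln (h (y $ i))))"
proof -
  interpret legendre_generator "total_cumulant M h" "total_log_partition M h" "mean_vector M h"
      "natural_domain M h :: (real ^ 'n) set"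
    by (rule legendre_total_cumulant)
  let ?f = "total_log_partition M h" and ?g = "mean_vector M h"
  let ?S = "natural_domain M h :: (real ^ 'n) set"
  let ?k = "\<Sum>i\<in>UNIV. ln (h (y $ i))"
  have "\<exists>c. convex_conjugate (total_cumulant M h) y = ereal c \<and>
      (\<forall>\<theta>. has_extended_value ?S (bregman (total_cumulant M h) \<theta>) s
         (total_cumulant M h \<theta> + ereal (c - y \<bullet> \<theta>))) \<and>
      has_extended_value ?S (log_likelihood M h y) s (ereal (c + ?k))"
  proof (cases "s \<in> embed ` ?S")
    case True
    then obtain t where t: "t \<in> ?S" "s = embed t" by blast
    have y: "y = ?g t"
      using sat True t gradient_F
      by (auto simp: saturated_parameter_def has_extended_value_def inj_eq[OF inj_embed])
    have "bregman (total_cumulant M h) \<theta> t = total_cumulant M h \<theta> + ereal ((y \<bullet> t - ?f t) - y \<bullet> \<theta>)" for \<theta>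
      using t by (simp add: bregman_F y algebra_simps)
    moreover have "log_likelihood M h y t = ereal ((y \<bullet> t - ?f t) + ?k)"
      using t by (simp add: log_likelihood_eq response)
    moreover have "convex_conjugate (total_cumulant M h) y = ereal (y \<bullet> t - ?f t)"
      using conjugate_gradient[OF t(1)] y by simp
    ultimately show ?thesis using True t by (auto simp: has_extended_value_def)
  next
    case False
    let ?K = "toward ?S s"
    have "convex_conjugate (total_cumulant M h) y \<noteq> \<infinity>"
      using fin some_infinite[OF sat False] by blast
    then obtain c where c: "convex_conjugate (total_cumulant M h) y = ereal c"
      using conjugate_not_minf by (metis ereal_cases)
    note lims = tendsto_at_saturation[OF c eventually_toward mean_vector_tendsto[OF sat False]
        first_order_small[OF sat False]]
    have "(bregman (total_cumulant M h) \<theta> \<longlongrightarrow> total_cumulant M h \<theta> + ereal (c - y \<bullet> \<theta>)) ?K" for \<theta>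
    proof -
      \<comment> \<open>Adding and subtracting \<open>y \<bullet> (\<theta> - t)\<close> splits the
        divergence into the conjugate objective, tending to \<open>c\<close>, and a first-order
        term, tending to 0.\<close>
      have "((\<lambda>t. (y \<bullet> t - ?f t) + (y - ?g t) \<bullet> (\<theta> - t) - y \<bullet> \<theta>) \<longlongrightarrow> c + 0 - y \<bullet> \<theta>) ?K"
        by (intro tendsto_intros lims)
      then have "((\<lambda>t. total_cumulant M h \<theta> + ereal ((y \<bullet> t - ?f t) + (y - ?g t) \<bullet> (\<theta> - t) - y \<bullet> \<theta>))
          \<longlongrightarrow> total_cumulant M h \<theta> + ereal (c - y \<bullet> \<theta>)) ?K"
        by (cases "\<theta> \<in> ?S") (auto simp: total_cumulant_eq intro!: tendsto_intros)
      moreover have "eventually (\<lambda>t. bregman (total_cumulant M h) \<theta> t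
          = total_cumulant M h \<theta> + ereal ((y \<bullet> t - ?f t) + (y - ?g t) \<bullet> (\<theta> - t) - y \<bullet> \<theta>)) ?K"
        using eventually_toward
        by (rule eventually_mono) (simp add: bregman_F algebra_simps)
      ultimately show ?thesis by (simp add: tendsto_cong)
    qed
    moreover have "(log_likelihood M h y \<longlongrightarrow> ereal (c + ?k)) ?K"
    proof -
      have "((\<lambda>t. ereal (y \<bullet> t - ?f t + ?k)) \<longlongrightarrow> ereal (c + ?k)) ?K"
        by (intro tendsto_intros lims)
      moreover have "eventually (\<lambda>t. log_likelihood M h y t = ereal (y \<bullet> t - ?f t + ?k)) ?K"
        using eventually_toward by (rule eventually_mono) (simp add: log_likelihood_eq response)
      ultimately show ?thesis by (simp add: tendsto_cong)
    qed
    ultimately show ?thesis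
      using c False toward_proper[OF sat False] by (auto simp: has_extended_value_def)
  qed
  then show ?thesis
    using that by (auto simp: bregman_to_saturated_def dest!: extended_value_eq)
qed

text \<open>The estimate maps into the open natural domain, so it is a local maximum of a
  differentiable real function of the coefficient, and the derivative there vanishes in every
  direction \<open>d\<close>.\<close>

lemma score_equation:
  fixes X :: "real ^ 'p ^ 'n"
  assumes response: "\<And>i. 0 < h (y $ i)" and mle: "finite_mle M h X y \<beta>"
  shows "transpose X *v (y - mean_vector M h (X *v \<beta>)) = 0"
proof -
  interpret legendre_generator "total_cumulant M h" "total_log_partition M h" "mean_vector M h"
      "natural_domain M h :: (real ^ 'n) set"
    by (rule legendre_total_cumulant)
  let ?f = "total_log_partition M h" and ?S = "natural_domain M h :: (real ^ 'n) set"
  let ?w = "y - mean_vector M h (X *v \<beta>)"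
  have in_S: "X *v \<beta> \<in> ?S" using mle by (simp add: finite_mle_def)
  have lin: "((*v) X has_derivative (*v) X) (at \<beta>)"
    by (intro bounded_linear_imp_has_derivative matrix_vector_mul_bounded_linear)
  have "((\<lambda>b. y \<bullet> (X *v b) - ?f (X *v b)) has_derivative
      (\<lambda>d. y \<bullet> (X *v d) - (X *v d) \<bullet> mean_vector M h (X *v \<beta>))) (at \<beta>)"
    using deriv[OF in_S] unfolding gderiv_def
    by (intro has_derivative_diff has_derivative_inner_right lin has_derivative_compose[OF lin])
  moreover have "eventually (\<lambda>b. y \<bullet> (X *v b) - ?f (X *v b) \<le> y \<bullet> (X *v \<beta>) - ?f (X *v \<beta>)) (at \<beta>)"
  proof -
    have "isCont ((*v) X) \<beta>" using lin by (rule has_derivative_continuous)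
    then have "((*v) X \<longlongrightarrow> X *v \<beta>) (at \<beta>)" by (simp add: isCont_def)
    then have "eventually (\<lambda>b. X *v b \<in> ?S) (at \<beta>)" by (rule topological_tendstoD[OF _ open_S in_S])
    then show ?thesis
    proof eventually_elim
      case (elim b)
      have "log_likelihood M h y (X *v b) \<le> log_likelihood M h y (X *v \<beta>)"
        using mle by (auto simp: finite_mle_def is_arg_max_def not_less)
      then show ?case using elim in_S by (simp add: log_likelihood_eq response)
    qed
  qed
  ultimately have "(\<lambda>d. y \<bullet> (X *v d) - (X *v d) \<bullet> mean_vector M h (X *v \<beta>)) = (\<lambda>d. 0)"
    by (rule has_derivative_local_max)
  from fun_cong[OF this] have "?w \<bullet> (X *v d) = 0" for d
    by (simp add: inner_diff_left inner_commute[of "mean_vector M h (X *v \<beta>)"])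
  then have "(transpose X *v ?w) \<bullet> d = 0" for d
    by (simp add: dot_lmul_matrix)
  then show ?thesis using inner_eq_zero_iff by blast
qed

end

section \<open>The likelihood fit as dual Bregman projections\<close>

theorem mainTheorem4:
  fixes M :: "real measure" and h :: "real \<Rightarrow> real"
    and X :: "real ^ 'p ^ 'n" and y :: "real ^ 'n" and \<theta>y :: "ereal ^ 'n"
    and F G ll :: "real ^ 'n \<Rightarrow> ereal" and DFy :: "real ^ 'n \<Rightarrow> ereal"
    and \<Theta> E :: "(real ^ 'n) set"
  assumes family: "regular_expfam M h"
    and response: "\<And>i. 0 < h (y $ i)"
    and F: "F = total_cumulant M h"
    and G: "G = convex_conjugate F"
    and loglik: "ll = log_likelihood M h y"
    and domain: "\<Theta> = natural_domain M h"
    and manifold: "E = model_manifold X"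
    and saturated: "saturated_parameter M h y \<theta>y"
    and boundary: "(\<exists>i. \<bar>\<theta>y $ i\<bar> = \<infinity>) \<Longrightarrow> G y \<noteq> \<infinity>"
    and DFy: "DFy = (\<lambda>\<theta>. bregman_to_saturated M h \<theta> \<theta>y)"
  shows
    "(\<exists>c::real. \<forall>\<theta>. ll \<theta> = ereal (y \<bullet> \<theta>) - F \<theta> + ereal c) \<and>
     (\<exists>c::real. \<forall>\<theta>. DFy \<theta> = - ll \<theta> + ereal c) \<and>
     (\<forall>\<beta>. is_arg_max (\<lambda>\<beta>. ll (X *v \<beta>)) (\<lambda>_. True) \<beta> \<longleftrightarrow>
           is_arg_min DFy (\<lambda>\<theta>. \<theta> \<in> E) (X *v \<beta>)) \<and>
     (\<forall>\<beta>h \<theta>h \<mu>h. finite_mle M h X y \<beta>h \<and> \<theta>h = X *v \<beta>h \<and> \<mu>h = gradient F \<theta>h \<longrightarrow>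
        transpose X *v (y - \<mu>h) = 0 \<and>
        (\<forall>\<theta>\<in>E. DFy \<theta> = bregman F \<theta> \<theta>h + DFy \<theta>h) \<and>
        (\<forall>\<theta>\<in>E \<inter> \<Theta>. \<forall>\<mu>. \<mu> = gradient F \<theta> \<longrightarrow>
           bregman G y \<mu> = bregman G y \<mu>h + bregman G \<mu>h \<mu>) \<and>
        (\<forall>\<theta>. is_arg_min DFy (\<lambda>\<theta>. \<theta> \<in> E) \<theta> \<longleftrightarrow> \<theta> = \<theta>h) \<and>
        (\<forall>\<mu>. is_arg_min (\<lambda>\<mu>. bregman G y \<mu>) (\<lambda>\<mu>. \<mu> \<in> gradient F ` (E \<inter> \<Theta>)) \<mu> \<longleftrightarrow> \<mu> = \<mu>h) \<and>
        deviance M h y \<theta>y \<theta>h = 2 * bregman G y \<mu>h)"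
proof -
  interpret regular_family M h by unfold_locales (rule family)
  interpret legendre_generator F "total_log_partition M h" "mean_vector M h" \<Theta>
    unfolding F domain by (rule legendre_total_cumulant)
  let ?f = "total_log_partition M h" and ?g = "mean_vector M h"
  define k where "k = (\<Sum>i\<in>UNIV. ln (h (y $ i)))"
  \<comment> \<open>From here on the boundary is out of sight: \<open>DFy\<close> is
    \<open>F\<close> plus a finite affine function, with constant \<open>G y\<close>.\<close>
  obtain c where Gy: "G y = ereal c" and D: "\<And>\<theta>. DFy \<theta> = F \<theta> + ereal (c - y \<bullet> \<theta>)"
    and lls: "extended_value \<Theta> ll \<theta>y = ereal (c + k)"
    using saturated_values[OF saturated response] boundary
    unfolding G F DFy domain loglik k_def by blast
  have ll_eq: "ll \<theta> = (if \<theta> \<in> \<Theta> then ereal (y \<bullet> \<theta> - ?f \<theta> + k) else - \<infinity>)" for \<theta>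
    unfolding loglik domain k_def by (rule log_likelihood_eq[OF response])
  have D_eq: "DFy \<theta> = (if \<theta> \<in> \<Theta> then ereal (?f \<theta> - y \<bullet> \<theta> + c) else \<infinity>)" for \<theta>
    by (simp add: D F_eq)
  \<comment> \<open>This identity carries every statement about \<open>DFy\<close> to the mean
    coordinate, also when the saturated parameter is infinite.\<close>
  have bregman_G: "bregman G y (?g \<theta>) = DFy \<theta>" if "\<theta> \<in> \<Theta>" for \<theta>
    using bregman_conjugate[OF that, of y] Gy that by (simp add: G D_eq)
  have ll_F: "ll \<theta> = ereal (y \<bullet> \<theta>) - F \<theta> + ereal k" for \<theta>
    by (simp add: ll_eq F_eq)
  have D_ll: "DFy \<theta> = - ll \<theta> + ereal (c + k)" for \<theta>
    by (simp add: ll_eq D_eq)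
  have D_less: "DFy \<theta> < DFy \<theta>' \<longleftrightarrow> ll \<theta>' < ll \<theta>" for \<theta> \<theta>'
    by (auto simp: ll_eq D_eq)
  have argmax: "is_arg_max (\<lambda>\<beta>. ll (X *v \<beta>)) (\<lambda>_. True) \<beta> \<longleftrightarrow>
      is_arg_min DFy (\<lambda>\<theta>. \<theta> \<in> E) (X *v \<beta>)" for \<beta>
    by (auto simp: is_arg_max_def is_arg_min_def manifold model_manifold_def D_less)
  have fit: "transpose X *v (y - \<mu>h) = 0 \<and>
        (\<forall>\<theta>\<in>E. DFy \<theta> = bregman F \<theta> \<theta>h + DFy \<theta>h) \<and>
        (\<forall>\<theta>\<in>E \<inter> \<Theta>. \<forall>\<mu>. \<mu> = gradient F \<theta> \<longrightarrow>
           bregman G y \<mu> = bregman G y \<mu>h + bregman G \<mu>h \<mu>) \<and>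
        (\<forall>\<theta>. is_arg_min DFy (\<lambda>\<theta>. \<theta> \<in> E) \<theta> \<longleftrightarrow> \<theta> = \<theta>h) \<and>
        (\<forall>\<mu>. is_arg_min (\<lambda>\<mu>. bregman G y \<mu>) (\<lambda>\<mu>. \<mu> \<in> gradient F ` (E \<inter> \<Theta>)) \<mu> \<longleftrightarrow> \<mu> = \<mu>h) \<and>
        deviance M h y \<theta>y \<theta>h = 2 * bregman G y \<mu>h"
    if mle: "finite_mle M h X y \<beta>h" and \<theta>h: "\<theta>h = X *v \<beta>h" and \<mu>h: "\<mu>h = gradient F \<theta>h"
    for \<beta>h \<theta>h \<mu>h
  proof -
    have in_\<Theta>: "\<theta>h \<in> \<Theta>" using mle by (simp add: finite_mle_def \<theta>h domain)
    have in_E: "\<theta>h \<in> E" by (simp add: manifold model_manifold_def \<theta>h)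
    have \<mu>h_eq: "\<mu>h = ?g \<theta>h" using gradient_F[OF in_\<Theta>] \<mu>h by simp
    have score: "transpose X *v (y - \<mu>h) = 0"
      unfolding \<mu>h_eq \<theta>h by (rule score_equation[OF response mle])
    \<comment> \<open>Differences of points of \<open>E\<close> lie in the column space, to which
      the score equation makes the residual orthogonal.\<close>
    have orth: "(y - \<mu>h) \<bullet> (\<theta> - \<theta>h) = 0" if "\<theta> \<in> E" for \<theta>
    proof -
      obtain \<beta> where "\<theta> = X *v \<beta>" using \<open>\<theta> \<in> E\<close> by (auto simp: manifold model_manifold_def)
      then have "(y - \<mu>h) \<bullet> (\<theta> - \<theta>h) = (y - \<mu>h) \<bullet> (X *v (\<beta> - \<beta>h))"
        by (simp add: \<theta>h matrix_vector_mult_diff_distrib)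
      also have "\<dots> = (transpose X *v (y - \<mu>h)) \<bullet> (\<beta> - \<beta>h)"
        unfolding transpose_matrix_vector dot_lmul_matrix ..
      finally show ?thesis unfolding score by simp
    qed
    \<comment> \<open>The two sides differ by the cross term
      \<open>(y - \<mu>h) \<bullet> (\<theta> - \<theta>h)\<close>, which is zero. Outside \<Theta>
      both sides are infinite.\<close>
    have pythagoras: "DFy \<theta> = bregman F \<theta> \<theta>h + DFy \<theta>h" if "\<theta> \<in> E" for \<theta>
      using orth[OF that] in_\<Theta>
      by (cases "\<theta> \<in> \<Theta>")
         (auto simp: bregman_F D_eq F_eq \<mu>h_eq inner_diff_left inner_diff_right)
    have dual: "bregman G y \<mu> = bregman G y \<mu>h + bregman G \<mu>h \<mu>"
      if "\<theta> \<in> E \<inter> \<Theta>" "\<mu> = gradient F \<theta>" for \<theta> \<mu>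
      using that pythagoras[of \<theta>] in_\<Theta> bregman_duality[OF in_\<Theta>, of \<theta>]
      by (simp add: gradient_F \<mu>h_eq bregman_G G[symmetric] add.commute)
    have less: "DFy \<theta>h < DFy \<theta>" if "\<theta> \<in> E" "\<theta> \<noteq> \<theta>h" for \<theta>
    proof -
      \<comment> \<open>Finiteness of \<open>DFy \<theta>h\<close> keeps the inequality strict after
        addition.\<close>
      have "DFy \<theta>h + 0 < DFy \<theta>h + bregman F \<theta> \<theta>h"
        using bregman_F_pos[OF in_\<Theta> that(2)] in_\<Theta> by (intro ereal_less_add) (auto simp: D_eq)
      then show ?thesis by (simp add: pythagoras[OF that(1)] add.commute)
    qed
    have e_proj: "is_arg_min DFy (\<lambda>\<theta>. \<theta> \<in> E) \<theta> \<longleftrightarrow> \<theta> = \<theta>h" for \<theta>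
      using less in_E unfolding is_arg_min_def by (metis less_asym)
    have m_proj: "is_arg_min (\<lambda>\<mu>. bregman G y \<mu>) (\<lambda>\<mu>. \<mu> \<in> gradient F ` (E \<inter> \<Theta>)) \<mu> \<longleftrightarrow> \<mu> = \<mu>h" for \<mu>
    proof -
      have mem: "\<mu>h \<in> gradient F ` (E \<inter> \<Theta>)" using in_E in_\<Theta> \<mu>h by blast
      have "bregman G y \<mu>h < bregman G y \<nu>" if "\<nu> \<in> gradient F ` (E \<inter> \<Theta>)" "\<nu> \<noteq> \<mu>h" for \<nu>
      proof -
        obtain \<theta> where \<theta>: "\<theta> \<in> E" "\<theta> \<in> \<Theta>" "\<nu> = ?g \<theta>" using \<open>\<nu> \<in> _\<close> by (auto simp: gradient_F)
        then have "\<theta> \<noteq> \<theta>h" using \<open>\<nu> \<noteq> \<mu>h\<close> \<mu>h_eq by auto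
        then show ?thesis using less[of \<theta>] \<theta> in_\<Theta> by (simp add: \<mu>h_eq bregman_G)
      qed
      then show ?thesis using mem unfolding is_arg_min_def by (metis less_asym)
    qed
    \<comment> \<open>The carrier term \<open>k\<close> occurs in both log-likelihoods and cancels,
      leaving \<open>DFy \<theta>h\<close>.\<close>
    have "deviance M h y \<theta>y \<theta>h = 2 * bregman G y \<mu>h"
      unfolding deviance_def loglik[symmetric] domain[symmetric] lls \<mu>h_eq bregman_G[OF in_\<Theta>]
      using in_\<Theta> by (simp add: ll_eq D_eq algebra_simps)
    with score pythagoras dual e_proj m_proj show ?thesis by blast
  qed
  show ?thesis using ll_F D_ll argmax fit by blast
qed

end
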